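(* Assume that the monotone operator $g:Q\to E^*$ is Hölder-continuous with constant $L_\nu$ for some $\nu\in[0,1]$, i.e. $\|g(x)-g(y)\|_*\le L_\nu\|x-y\|^\nu$ for all $x,y\in Q$, and that the Generalized Mirror Prox algorithm (described in the context) is run with accuracy $\varepsilon>0$, exact operator values and exact prox-mappings ($\delta_u=0$, $\delta_{pc,k}=0$, $\delta_{pu}=0$) and $\delta_{c,k}=\varepsilon/2$. Let $C\subseteq Q$ be a nonempty convex compact set. Then, for all $k\ge1$, $$\max_{u\in C}\langle g(u),\widehat w_k-u\rangle\le\frac{2L_\nu^{\frac{2}{1+\nu}}}{k\,\varepsilon^{\frac{1-\nu}{1+\nu}}}\max_{u\in C}V[z_0](u)+\frac{\varepsilon}{2}.$$
   Context: $E$ is a finite-dimensional real vector space with norm $\|\cdot\|$, $E^*$ its dual, $\langle s,x\rangle$ the value of $s\in E^*$ at $x\in E$, $\|s\|_*=\max\{\langle s,x\rangle:\|x\|\le1\}$. $Q\subset E$ is convex (not necessarily compact), and $g:Q\to E^*$ is continuous and monotone: $\langle g(x)-g(y),x-y\rangle\ge0$ for $x,y\in Q$. The underlying variational inequality (find $x_*\in Q$ with $\langle g(x),x_*-x\rangle\le0$ for all $x\in Q$) is assumed to have a solution. Prox-setup: $d:Q\to\mathbb R$ is continuous, convex, with $\min_{Q}d=0$; it is continuously differentiable on a set $Q^0\subseteq Q$ containing the relative interior of $Q$, and $1$-strongly convex: $d(y)-d(x)-\langle\nabla d(x),y-x\rangle\ge\frac12\|y-x\|^2$ for $x\in Q^0$,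 $y\in Q$. Bregman divergence: $V[z](x)=d(x)-d(z)-\langle\nabla d(z),x-z\rangle$, $x\in Q$, $z\in Q^0$. Exact prox-mapping: for $\bar x\in Q^0$, $s\in E^*$, $M>0$, $\arg\min_{x\in Q}\{\langle s,x\rangle+MV[\bar x](x)\}$ denotes a point $\tilde x\in Q^0$ with $\langle s+M[\nabla d(\tilde x)-\nabla d(\bar x)],u-\tilde x\rangle\ge0$ for all $u\in Q$; it is assumed to be computable. Generalized Mirror Prox algorithm (in the configuration used here). Input: $\varepsilon>0$ and an initial guess $M_{-1}>0$ for the constant $L(\varepsilon/2)=\varepsilon^{-\frac{1-\nu}{1+\nu}}L_\nu^{\frac{2}{1+\nu}}$ (the algorithm does not use $\nu$ or $L_\nu$). Set $z_0=\arg\min_{u\in Q}d(u)\in Q^0$. For $k=0,1,2,\dots$: for $i_k=0,1,2,\dots$ put $M_k=2^{i_k-1}M_{k-1}$ and compute $$w_k=\arg\min_{x\in Q}\{\langle g(z_k),x\rangle+M_kV[z_k](x)\},\qquad z_{k+1}=\arg\min_{x\in Q}\{\langle g(w_k),x\rangle+M_kV[z_k](x)\},$$ stopping at the first $i_k$ for which $$\langle g(w_k)-g(z_k),w_k-z_{k+1}\rangle\le\frac{M_k}{2}\left(\|w_k-z_k\|^2+\|w_k-z_{k+1}\|^2\right)+\frac{\varepsilon}{2};$$ the corresponding $M_k,w_k,z_{k+1}$ are kept. The output after $k$ iterations is $\widehat w_k=\left(\sum_{i=0}^{k-1}M_i^{-1}\right)^{-1}\sum_{i=0}^{k-1}M_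i^{-1}w_i$.
   Formalization: The initial guess is additionally assumed to satisfy M_{-1} ≤ 4L(ε/2) (so L_ν > 0), because the stated bound is false for larger guesses, e.g. constant g on [-1,1] with huge M_{-1} and k=1. *)

theory Defs
  imports "HOL-Analysis.Analysis"
begin

text \<open>
  The space \<open>E\<close> is a type of class \<^class>\<open>real_normed_vector\<close> (an arbitrary norm, no inner
  product); its dual is \<open>'a \<Rightarrow>\<^sub>L real\<close>, whose operator norm is the dual norm
  \<open>max {\<langle>s, x\<rangle>. \<parallel>x\<parallel> \<le> 1}\<close>, as the following lemma confirms.
\<close>

lemma norm_blinfun_eq_SUP:
  fixes s :: "'a::real_normed_vector \<Rightarrow>\<^sub>L real"
  shows "norm s = (SUP x\<in>{x. norm x \<le> 1}. blinfun_apply s x)"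
proof (rule antisym)
  have ub: "blinfun_apply s x \<le> norm s" if "norm x \<le> 1" for x
  proof -
    have "blinfun_apply s x \<le> norm s * norm x"
      using norm_blinfun[of s x] by simp
    also have "\<dots> \<le> norm s * 1"
      using that by (intro mult_left_mono) auto
    finally show ?thesis by simp
  qed
  have bdd: "bdd_above (blinfun_apply s ` {x. norm x \<le> 1})"
    using ub by (intro bdd_aboveI2) auto
  show "(SUP x\<in>{x. norm x \<le> 1}. blinfun_apply s x) \<le> norm s"
  proof (rule cSUP_least)
    have "(0::'a) \<in> {x. norm x \<le> 1}" by simp
    then show "{x::'a. norm x \<le> 1} \<noteq> {}" by blast
  qed (use ub in auto)
  let ?S = "SUP x\<in>{x. norm x \<le> 1}. blinfun_apply s x"
  have le: "blinfun_apply s x \<le> ?S" if "norm x \<le> 1" for x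
    using that bdd by (intro cSUP_upper) auto
  have S0: "0 \<le> ?S" using le[of 0] by (simp add: blinfun.zero_right)
  show "norm s \<le> ?S"
  proof (rule norm_blinfun_bound[OF S0])
    fix x
    show "norm (blinfun_apply s x) \<le> ?S * norm x"
    proof (cases "x = 0")
      case True then show ?thesis by (simp add: blinfun.zero_right)
    next
      case False
      have "blinfun_apply s x / norm x \<le> ?S"
        using le[of "inverse (norm x) *\<^sub>R x"] False
        by (simp add: blinfun.scaleR_right divide_inverse mult.commute)
      moreover have "- (blinfun_apply s x / norm x) \<le> ?S"
        using le[of "- (inverse (norm x) *\<^sub>R x)"] False
        by (simp add: blinfun.scaleR_right blinfun.minus_right divide_inverse mult.commute)
      ultimately have "\<bar>blinfun_apply s x / norm x\<bar> \<le> ?S" by linarith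
      with False show ?thesis by (simp add: abs_divide divide_le_eq)
    qed
  qed
qed

definition monotone_operator_on ::
    "'a::real_normed_vector set \<Rightarrow> ('a \<Rightarrow> 'a \<Rightarrow>\<^sub>L real) \<Rightarrow> bool" where
  "monotone_operator_on Q g \<longleftrightarrow> (\<forall>x\<in>Q. \<forall>y\<in>Q. 0 \<le> blinfun_apply (g x - g y) (x - y))"

text \<open>
  \<open>gd\<close> plays the role of the gradient of \<open>d\<close>. As \<open>d\<close> matters on \<open>Q\<close> only, and \<open>Q\<close> need not be
  full-dimensional, the derivative is taken within \<open>Q\<close>.
\<close>

definition prox_setup ::
    "'a::real_normed_vector set \<Rightarrow> 'a set \<Rightarrow> ('a \<Rightarrow> real) \<Rightarrow> ('a \<Rightarrow> 'a \<Rightarrow>\<^sub>L real) \<Rightarrow> bool" where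
  "prox_setup Q Q0 d gd \<longleftrightarrow>
     continuous_on Q d \<and> convex_on Q d \<and>
     (\<exists>x\<in>Q. d x = 0) \<and> (\<forall>x\<in>Q. 0 \<le> d x) \<and>
     rel_interior Q \<subseteq> Q0 \<and> Q0 \<subseteq> Q \<and>
     (\<forall>x\<in>Q0. (d has_derivative blinfun_apply (gd x)) (at x within Q)) \<and>
     continuous_on Q0 gd \<and>
     (\<forall>x\<in>Q0. \<forall>y\<in>Q. (1/2) * (norm (y - x))\<^sup>2 \<le> d y - d x - blinfun_apply (gd x) (y - x))"

definition bregman ::
    "('a::real_normed_vector \<Rightarrow> real) \<Rightarrow> ('a \<Rightarrow> 'a \<Rightarrow>\<^sub>L real) \<Rightarrow> 'a \<Rightarrow> 'a \<Rightarrow> real" where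
  "bregman d gd z x = d x - d z - blinfun_apply (gd z) (x - z)"

definition is_prox ::
    "'a::real_normed_vector set \<Rightarrow> 'a set \<Rightarrow> ('a \<Rightarrow> 'a \<Rightarrow>\<^sub>L real) \<Rightarrow>
     'a \<Rightarrow> ('a \<Rightarrow>\<^sub>L real) \<Rightarrow> real \<Rightarrow> 'a \<Rightarrow> bool" where
  "is_prox Q Q0 gd xbar s M xt \<longleftrightarrow>
     xt \<in> Q0 \<and> (\<forall>u\<in>Q. 0 \<le> blinfun_apply (s + M *\<^sub>R (gd xt - gd xbar)) (u - xt))"

text \<open>
  Under \<^const>\<open>prox_setup\<close> and for \<open>M > 0\<close> a prox point is unique if it exists, so the choice
  below is harmless.
\<close>

definition prox ::
    "'a::real_normed_vector set \<Rightarrow> 'a set \<Rightarrow> ('a \<Rightarrow> 'a \<Rightarrow>\<^sub>L real) \<Rightarrow>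
     'a \<Rightarrow> ('a \<Rightarrow>\<^sub>L real) \<Rightarrow> real \<Rightarrow> 'a" where
  "prox Q Q0 gd xbar s M = (SOME xt. is_prox Q Q0 gd xbar s M xt)"

context
  fixes Q Q0 :: "'a::real_normed_vector set"
    and gd g :: "'a \<Rightarrow> 'a \<Rightarrow>\<^sub>L real"
begin

definition prox_w :: "real \<Rightarrow> 'a \<Rightarrow> 'a" where
  "prox_w M z = prox Q Q0 gd z (g z) M"

definition prox_z :: "real \<Rightarrow> 'a \<Rightarrow> 'a" where
  "prox_z M z = prox Q Q0 gd z (g (prox_w M z)) M"

definition accepted :: "real \<Rightarrow> real \<Rightarrow> 'a \<Rightarrow> bool" where
  "accepted eps M z \<longleftrightarrow>
     (let w = prox_w M z; z' = prox_z M z in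
       blinfun_apply (g w - g z) (w - z')
         \<le> M / 2 * ((norm (w - z))\<^sup>2 + (norm (w - z'))\<^sup>2) + eps / 2)"

definition trial_M :: "real \<Rightarrow> nat \<Rightarrow> real" where
  "trial_M Mprev i = 2 powi (int i - 1) * Mprev"

definition inner_index :: "real \<Rightarrow> real \<Rightarrow> 'a \<Rightarrow> nat" where
  "inner_index eps Mprev z = (LEAST i. accepted eps (trial_M Mprev i) z)"

text \<open>
  The state before iteration \<open>k\<close> is the pair consisting of \<open>M\<close> with index \<open>k - 1\<close> and \<open>z\<close> with
  index \<open>k\<close>; \<open>Mi\<close> is the initial guess, that is, \<open>M\<close> with index \<open>- 1\<close>.
\<close>

primrec gmp_state :: "real \<Rightarrow> real \<Rightarrow> 'a \<Rightarrow> nat \<Rightarrow> real \<times> 'a" where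
  "gmp_state eps Mi z0 0 = (Mi, z0)"
| "gmp_state eps Mi z0 (Suc k) =
     (let (Mprev, z) = gmp_state eps Mi z0 k;
          M = trial_M Mprev (inner_index eps Mprev z)
      in (M, prox_z M z))"

definition gmp_M :: "real \<Rightarrow> real \<Rightarrow> 'a \<Rightarrow> nat \<Rightarrow> real" where
  "gmp_M eps Mi z0 k = fst (gmp_state eps Mi z0 (Suc k))"

definition gmp_z :: "real \<Rightarrow> real \<Rightarrow> 'a \<Rightarrow> nat \<Rightarrow> 'a" where
  "gmp_z eps Mi z0 k = snd (gmp_state eps Mi z0 k)"

definition gmp_w :: "real \<Rightarrow> real \<Rightarrow> 'a \<Rightarrow> nat \<Rightarrow> 'a" where
  "gmp_w eps Mi z0 k = prox_w (gmp_M eps Mi z0 k) (gmp_z eps Mi z0 k)"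

definition gmp_output :: "real \<Rightarrow> real \<Rightarrow> 'a \<Rightarrow> nat \<Rightarrow> 'a" where
  "gmp_output eps Mi z0 k =
     inverse (\<Sum>i<k. inverse (gmp_M eps Mi z0 i)) *\<^sub>R
       (\<Sum>i<k. inverse (gmp_M eps Mi z0 i) *\<^sub>R gmp_w eps Mi z0 i)"

end

end

theory Submission
  imports Defs
begin

text \<open>
  Adding the optimality conditions of the two prox steps to the acceptance test gives, for every
  \<open>u \<in> Q\<close>, \<open>\<langle>g w\<^sub>k, w\<^sub>k - u\<rangle> \<le> M\<^sub>k (V[z\<^sub>k](u) - V[z\<^sub>k\<^sub>+\<^sub>1](u)) + \<epsilon>/2\<close>. Dividing by \<open>M\<^sub>k\<close>, the Bregman
  terms telescope, and monotonicity replaces \<open>g w\<^sub>k\<close> by \<open>g u\<close>. Hoelder continuity makes the test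
  succeed as soon as \<open>M\<close> reaches \<open>\<Lambda> = \<epsilon> powr (-(1-\<nu>)/(1+\<nu>)) * L powr (2/(1+\<nu>))\<close>, so that doubling
  never overshoots \<open>2 \<Lambda>\<close> and the weights \<open>1 / M\<^sub>k\<close> add up to at least \<open>k / (2 \<Lambda>)\<close>.
\<close>

section \<open>Scalar inequalities behind the acceptance test\<close>

text \<open>Both bases are at most \<open>max x y\<close>, and the exponents add up to 1.\<close>

lemma powr_mult_powr_le_add:
  fixes x y p :: real
  assumes "0 \<le> x" "0 \<le> y" "0 \<le> p" "p \<le> 1"
  shows "x powr p * y powr (1 - p) \<le> x + y"
proof -
  let ?m = "max x y"
  have "x powr p * y powr (1 - p) \<le> ?m powr p * ?m powr (1 - p)"
    using assms by (intro mult_mono powr_mono2) auto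
  also have "\<dots> = ?m"
    using assms by (cases "?m = 0") (auto simp flip: powr_add)
  also have "\<dots> \<le> x + y"
    using assms by auto
  finally show ?thesis .
qed

text \<open>
  By AM-GM the right-hand side is at least \<open>b * sqrt (M * (M * a\<^sup>2 + \<epsilon>))\<close>; the previous lemma, with
  exponent \<open>\<nu>\<close>, then bounds the inner sum from below by a multiple of \<open>a powr (2 * \<nu>)\<close>.
\<close>

lemma hoelder_young:
  fixes a b L M \<epsilon> \<nu> :: real
  assumes "0 \<le> a" "0 \<le> b" "0 < L" "0 < \<epsilon>" "0 \<le> \<nu>" "\<nu> \<le> 1"
    and M: "\<epsilon> powr (- ((1 - \<nu>) / (1 + \<nu>))) * L powr (2 / (1 + \<nu>)) \<le> M"
  shows "L * a powr \<nu> * b \<le> M / 2 * (a\<^sup>2 + b\<^sup>2) + \<epsilon> / 2"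
proof -
  have "0 < \<epsilon> powr (- ((1 - \<nu>) / (1 + \<nu>))) * L powr (2 / (1 + \<nu>))"
    using assms by simp
  then have Mpos: "0 < M" using M by linarith
  \<comment> \<open>Raising to the power \<open>1 + \<nu>\<close> clears the denominators in the
    exponents and leads to the polynomial-like form \<open>L2\<close>.\<close>
  have "(\<epsilon> powr (- ((1 - \<nu>) / (1 + \<nu>))) * L powr (2 / (1 + \<nu>))) powr (1 + \<nu>) \<le> M powr (1 + \<nu>)"
    using assms M by (intro powr_mono2) auto
  moreover have "(\<epsilon> powr (- ((1 - \<nu>) / (1 + \<nu>))) * L powr (2 / (1 + \<nu>))) powr (1 + \<nu>)
      = \<epsilon> powr (- (1 - \<nu>)) * L powr 2"
  proof -
    have "- ((1 - \<nu>) / (1 + \<nu>)) * (1 + \<nu>) = - (1 - \<nu>)" "2 / (1 + \<nu>) * (1 + \<nu>) = 2"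
      using assms by (auto simp: divide_simps)
    then show ?thesis by (simp only: powr_mult powr_powr)
  qed
  ultimately have "\<epsilon> powr (- (1 - \<nu>)) * L\<^sup>2 \<le> M powr (1 + \<nu>)"
    using assms by simp
  then have "\<epsilon> powr (1 - \<nu>) * (\<epsilon> powr (- (1 - \<nu>)) * L\<^sup>2) \<le> \<epsilon> powr (1 - \<nu>) * M powr (1 + \<nu>)"
    by (intro mult_left_mono) auto
  moreover have "\<epsilon> powr (1 - \<nu>) * \<epsilon> powr (- (1 - \<nu>)) = 1"
    using assms by (simp only: powr_add [symmetric]) simp
  ultimately have L2: "L\<^sup>2 \<le> M powr (1 + \<nu>) * \<epsilon> powr (1 - \<nu>)"
    by (metis mult.assoc mult.commute mult.left_neutral)
  have "(L * a powr \<nu>)\<^sup>2 \<le> M * (M * a\<^sup>2 + \<epsilon>)"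
  proof (cases "a = 0")
    \<comment> \<open>\<open>0 powr \<nu>\<close> is 0 even for \<open>\<nu> = 0\<close>, so the
      left side vanishes.\<close>
    case True
    then show ?thesis using Mpos assms by simp
  next
    case False
    then have apos: "0 < a" using assms by simp
    have sq: "(a powr \<nu>)\<^sup>2 = (a\<^sup>2) powr \<nu>"
      using apos by (simp add: power2_eq_square powr_mult)
    have "(L * a powr \<nu>)\<^sup>2 = L\<^sup>2 * (a\<^sup>2) powr \<nu>"
      by (simp add: power_mult_distrib sq)
    also have "\<dots> \<le> M powr (1 + \<nu>) * \<epsilon> powr (1 - \<nu>) * (a\<^sup>2) powr \<nu>"
      using L2 by (intro mult_right_mono) auto
    also have "\<dots> = M * ((M * a\<^sup>2) powr \<nu> * \<epsilon> powr (1 - \<nu>))"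
      using Mpos apos by (simp add: powr_add powr_mult)
    also have "\<dots> \<le> M * (M * a\<^sup>2 + \<epsilon>)"
      using Mpos assms by (intro mult_left_mono powr_mult_powr_le_add) auto
    finally show ?thesis .
  qed
  then have "L * a powr \<nu> * b \<le> sqrt (M * (M * a\<^sup>2 + \<epsilon>)) * b"
    using assms by (intro mult_right_mono real_le_rsqrt) auto
  also have "\<dots> = sqrt ((M * b\<^sup>2) * (M * a\<^sup>2 + \<epsilon>))"
    using assms by (simp add: real_sqrt_mult)
  also have "\<dots> \<le> (M * b\<^sup>2 + (M * a\<^sup>2 + \<epsilon>)) / 2"
    using Mpos assms by (intro arith_geo_mean_sqrt) auto
  finally show ?thesis by (simp add: algebra_simps add_divide_distrib)
qed

section \<open>Bregman divergences and prox steps\<close>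

text \<open>All values of \<open>d\<close> cancel on the right; the two terms with
  \<open>gd z\<close> combine because \<open>u - z = (u - y) + (y - z)\<close>.\<close>

lemma bregman_three_point:
  "blinfun_apply (gd y - gd z) (u - y) = bregman d gd z u - bregman d gd y u - bregman d gd z y"
proof -
  have "blinfun_apply (gd z) (u - z) = blinfun_apply (gd z) (u - y) + blinfun_apply (gd z) (y - z)"
    by (simp flip: blinfun.add_right)
  then show ?thesis
    by (simp add: bregman_def blinfun.diff_left)
qed

lemma is_prox_bregman:
  assumes "is_prox Q Q0 gd z s M y" "u \<in> Q"
  shows "blinfun_apply s (y - u)
    \<le> M * (bregman d gd z u - bregman d gd y u - bregman d gd z y)"
proof -
  have "0 \<le> blinfun_apply (s + M *\<^sub>R (gd y - gd z)) (u - y)"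
    using assms by (simp add: is_prox_def)
  also have "\<dots> = - blinfun_apply s (y - u) + M * blinfun_apply (gd y - gd z) (u - y)"
    by (simp add: blinfun.add_left blinfun.scaleR_left flip: blinfun.minus_right)
  finally show ?thesis
    by (simp add: bregman_three_point [where d = d])
qed

section \<open>Trial values of the line search\<close>

lemma trial_M_pos: "0 < Mprev \<Longrightarrow> 0 < trial_M Mprev i"
  by (simp add: trial_M_def)

lemma trial_M_0: "trial_M Mprev 0 = Mprev / 2"
  by (simp add: trial_M_def power_int_minus)

lemma trial_M_Suc: "trial_M Mprev (Suc i) = 2 * trial_M Mprev i"
  by (simp add: trial_M_def power_int_diff)

text \<open>Repeated doubling passes every threshold; with \<open>c = Lam\<close> this makes the
  inner loop terminate.\<close>

lemma trial_M_unbounded: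
  assumes "0 < Mprev"
  shows "\<exists>i. c \<le> trial_M Mprev i"
proof -
  have eq: "trial_M Mprev i = 2 ^ i * (Mprev / 2)" for i
    by (induction i) (simp_all add: trial_M_0 trial_M_Suc)
  obtain i where "c / (Mprev / 2) < 2 ^ i"
    using real_arch_pow [of 2 "c / (Mprev / 2)"] by auto
  then have "c \<le> trial_M Mprev i"
    using assms by (simp add: eq field_simps)
  then show ?thesis ..
qed

section \<open>The iterates and their basic properties\<close>

locale mirror_prox =
  fixes Q Q0 :: "'a::real_normed_vector set"
    and g gd :: "'a \<Rightarrow> 'a \<Rightarrow>\<^sub>L real"
    and d :: "'a \<Rightarrow> real"
    and L \<nu> \<epsilon> Mi :: real
    and z0 :: 'a
  assumes mono_g: "monotone_operator_on Q g"
    and prox: "prox_setup Q Q0 d gd"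
    and prox_exists: "\<And>x s M. x \<in> Q0 \<Longrightarrow> 0 < M \<Longrightarrow> \<exists>xt. is_prox Q Q0 gd x s M xt"
    and nu: "0 \<le> \<nu>" "\<nu> \<le> 1"
    and L_pos: "0 < L"
    and hoelder: "\<And>x y. x \<in> Q \<Longrightarrow> y \<in> Q \<Longrightarrow> norm (g x - g y) \<le> L * norm (x - y) powr \<nu>"
    and eps: "0 < \<epsilon>"
    and Mi_pos: "0 < Mi"
    and z0: "z0 \<in> Q0"
begin

text \<open>This is the constant \<open>L(\<epsilon>/2)\<close> that the initial guess
  \<open>Mi\<close> estimates.\<close>

definition Lam :: real where
  "Lam = \<epsilon> powr (- ((1 - \<nu>) / (1 + \<nu>))) * L powr (2 / (1 + \<nu>))"

text \<open>\<open>Ms k\<close> is the value that iteration \<open>k\<close> starts from: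
  \<open>Ms 0\<close> is \<open>Mi\<close>, and \<open>Ms (Suc k)\<close> is
  \<open>M k\<close>.\<close>

abbreviation "Ms k \<equiv> fst (gmp_state Q Q0 gd g \<epsilon> Mi z0 k)"
abbreviation "M k \<equiv> gmp_M Q Q0 gd g \<epsilon> Mi z0 k"
abbreviation "z k \<equiv> gmp_z Q Q0 gd g \<epsilon> Mi z0 k"
abbreviation "w k \<equiv> gmp_w Q Q0 gd g \<epsilon> Mi z0 k"
abbreviation "V \<equiv> bregman d gd"

lemma Q0_subset: "x \<in> Q0 \<Longrightarrow> x \<in> Q"
  using prox by (auto simp: prox_setup_def)

lemma bregman_ge: "x \<in> Q0 \<Longrightarrow> y \<in> Q \<Longrightarrow> (norm (y - x))\<^sup>2 / 2 \<le> V x y"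
  using prox by (auto simp: prox_setup_def bregman_def)

lemma bregman_nonneg: "x \<in> Q0 \<Longrightarrow> y \<in> Q \<Longrightarrow> 0 \<le> V x y"
  using bregman_ge [of x y] by (meson order_trans divide_nonneg_pos zero_le_power2 zero_less_numeral)

lemma is_prox_prox: "x \<in> Q0 \<Longrightarrow> 0 < m \<Longrightarrow> is_prox Q Q0 gd x s m (Defs.prox Q Q0 gd x s m)"
  unfolding prox_def by (rule someI_ex) (rule prox_exists)

lemma is_prox_prox_w: "x \<in> Q0 \<Longrightarrow> 0 < m \<Longrightarrow> is_prox Q Q0 gd x (g x) m (prox_w Q Q0 gd g m x)"
  unfolding prox_w_def by (rule is_prox_prox)

lemma is_prox_prox_z:
  "x \<in> Q0 \<Longrightarrow> 0 < m \<Longrightarrow> is_prox Q Q0 gd x (g (prox_w Q Q0 gd g m x)) m (prox_z Q Q0 gd g m x)"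
  unfolding prox_z_def by (rule is_prox_prox)

lemma prox_w_in: "x \<in> Q0 \<Longrightarrow> 0 < m \<Longrightarrow> prox_w Q Q0 gd g m x \<in> Q0"
  using is_prox_prox_w by (auto simp: is_prox_def)

lemma prox_z_in: "x \<in> Q0 \<Longrightarrow> 0 < m \<Longrightarrow> prox_z Q Q0 gd g m x \<in> Q0"
  using is_prox_prox_z by (auto simp: is_prox_def)

section \<open>Termination of the line search and the upper bound on its values\<close>

text \<open>The dual norm and Hoelder continuity reduce the test to \<open>hoelder_young\<close>
  with \<open>a = norm (v - x)\<close> and \<open>b = norm (v - y)\<close>.\<close>

lemma accepted_if_ge_Lam:
  assumes x: "x \<in> Q0" and m: "0 < m" "Lam \<le> m"
  shows "accepted Q Q0 gd g \<epsilon> m x"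
proof -
  define v y where "v = prox_w Q Q0 gd g m x" and "y = prox_z Q Q0 gd g m x"
  have "v \<in> Q" "x \<in> Q"
    using x m prox_w_in Q0_subset by (auto simp: v_def)
  have "blinfun_apply (g v - g x) (v - y) \<le> norm (g v - g x) * norm (v - y)"
    using norm_blinfun [of "g v - g x" "v - y"] by simp
  also have "\<dots> \<le> L * norm (v - x) powr \<nu> * norm (v - y)"
    using hoelder [OF \<open>v \<in> Q\<close> \<open>x \<in> Q\<close>] by (intro mult_right_mono) auto
  also have "\<dots> \<le> m / 2 * ((norm (v - x))\<^sup>2 + (norm (v - y))\<^sup>2) + \<epsilon> / 2"
    using L_pos eps nu m(2) by (intro hoelder_young) (auto simp: Lam_def)
  finally show ?thesis
    by (simp add: accepted_def Let_def v_def y_def)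
qed

lemma accepted_inner_index:
  assumes "x \<in> Q0" "0 < m"
  shows "accepted Q Q0 gd g \<epsilon> (trial_M m (inner_index Q Q0 gd g \<epsilon> m x)) x"
proof -
  obtain i where "Lam \<le> trial_M m i"
    using trial_M_unbounded assms by blast
  then have "accepted Q Q0 gd g \<epsilon> (trial_M m i) x"
    using assms by (intro accepted_if_ge_Lam trial_M_pos) auto
  then show ?thesis
    unfolding inner_index_def by (rule LeastI)
qed

text \<open>Either the first trial \<open>m / 2\<close> is accepted, or the trial before the
  accepted one was rejected and thus lies below \<open>Lam\<close>.\<close>

lemma trial_M_inner_index_le:
  assumes "x \<in> Q0" "0 < m" "m \<le> 4 * Lam"
  shows "trial_M m (inner_index Q Q0 gd g \<epsilon> m x) \<le> 2 * Lam"
proof (cases "inner_index Q Q0 gd g \<epsilon> m x")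
  case 0
  then show ?thesis using assms by (simp add: trial_M_0)
next
  case (Suc i)
  then have "\<not> accepted Q Q0 gd g \<epsilon> (trial_M m i) x"
    unfolding inner_index_def by (intro not_less_Least) simp
  then have "trial_M m i < Lam"
    using assms accepted_if_ge_Lam trial_M_pos by (meson not_le)
  then show ?thesis by (simp add: Suc trial_M_Suc)
qed

lemma gmp_M_eq: "M k = trial_M (Ms k) (inner_index Q Q0 gd g \<epsilon> (Ms k) (z k))"
  by (simp add: gmp_M_def gmp_z_def case_prod_beta Let_def)

lemma gmp_z_Suc: "z (Suc k) = prox_z Q Q0 gd g (M k) (z k)"
  by (simp add: gmp_M_def gmp_z_def case_prod_beta Let_def)

lemma gmp_invariant: "0 < Ms k \<and> z k \<in> Q0"
proof (induction k)
  case 0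
  then show ?case using Mi_pos z0 by (simp add: gmp_z_def)
next
  case (Suc k)
  then have "0 < M k" unfolding gmp_M_eq by (intro trial_M_pos) simp
  with Suc show ?case using prox_z_in by (simp add: gmp_z_Suc gmp_M_def del: gmp_state.simps)
qed

lemma gmp_M_pos: "0 < M k"
  using gmp_invariant [of "Suc k"] by (simp add: gmp_M_def del: gmp_state.simps)

lemma gmp_w_in: "w k \<in> Q0"
  using gmp_invariant gmp_M_pos by (simp add: gmp_w_def prox_w_in)

lemma gmp_M_le:
  assumes "Mi \<le> 4 * Lam"
  shows "M k \<le> 2 * Lam"
proof -
  \<comment> \<open>The induction carries \<open>4 * Lam\<close>, not \<open>2 * Lam\<close>: the
    first trial halves the incoming value, so this weaker bound suffices and admits a larger initial
    guess.\<close>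
  have step: "M k \<le> 2 * Lam" if "Ms k \<le> 4 * Lam" for k
    unfolding gmp_M_eq using gmp_invariant that by (intro trial_M_inner_index_le) auto
  have "Ms k \<le> 4 * Lam"
  proof (induction k)
    case 0
    then show ?case using assms by simp
  next
    case (Suc j)
    have "0 \<le> Lam" by (simp add: Lam_def)
    then show ?case using step [OF Suc] by (simp add: gmp_M_def del: gmp_state.simps)
  qed
  then show ?thesis by (rule step)
qed

section \<open>The estimate for one iteration and its summation\<close>

lemma gmp_step:
  assumes u: "u \<in> Q"
  shows "blinfun_apply (g (w k)) (w k - u) \<le> M k * (V (z k) u - V (z (Suc k)) u) + \<epsilon> / 2"
proof -
  note [simp] = gmp_M_pos gmp_invariant gmp_w_in Q0_subset
  have "is_prox Q Q0 gd (z k) (g (w k)) (M k) (z (Suc k))"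
    unfolding gmp_z_Suc gmp_w_def by (intro is_prox_prox_z) auto
  then have 1: "blinfun_apply (g (w k)) (z (Suc k) - u)
      \<le> M k * (V (z k) u - V (z (Suc k)) u - V (z k) (z (Suc k)))"
    using u by (rule is_prox_bregman)
  \<comment> \<open>The first prox step is tested at the second prox point, so that
    \<open>V (z k) (z (Suc k))\<close> cancels against \<open>1\<close>.\<close>
  have "is_prox Q Q0 gd (z k) (g (z k)) (M k) (w k)"
    unfolding gmp_w_def by (intro is_prox_prox_w) auto
  then have 2: "blinfun_apply (g (z k)) (w k - z (Suc k))
      \<le> M k * (V (z k) (z (Suc k)) - V (w k) (z (Suc k)) - V (z k) (w k))"
    by (rule is_prox_bregman) simp
  have "accepted Q Q0 gd g \<epsilon> (M k) (z k)"
    unfolding gmp_M_eq by (intro accepted_inner_index) auto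
  then have 3: "blinfun_apply (g (w k) - g (z k)) (w k - z (Suc k))
      \<le> M k / 2 * ((norm (w k - z k))\<^sup>2 + (norm (w k - z (Suc k)))\<^sup>2) + \<epsilon> / 2"
    by (simp add: accepted_def Let_def gmp_z_Suc gmp_w_def)
  \<comment> \<open>Strong convexity bounds the squares in the test by exactly the two divergences
    that \<open>2\<close> subtracts.\<close>
  have "(norm (w k - z k))\<^sup>2 / 2 + (norm (w k - z (Suc k)))\<^sup>2 / 2
      \<le> V (z k) (w k) + V (w k) (z (Suc k))"
    using bregman_ge [of "z k" "w k"] bregman_ge [of "w k" "z (Suc k)"]
    by (simp add: norm_minus_commute)
  then have "M k * ((norm (w k - z k))\<^sup>2 / 2 + (norm (w k - z (Suc k)))\<^sup>2 / 2)
      \<le> M k * (V (z k) (w k) + V (w k) (z (Suc k)))"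
    by (intro mult_left_mono) (auto intro: less_imp_le)
  with 3 have 4: "blinfun_apply (g (w k) - g (z k)) (w k - z (Suc k))
      \<le> M k * (V (z k) (w k) + V (w k) (z (Suc k))) + \<epsilon> / 2"
    by (simp add: algebra_simps)
  have "blinfun_apply (g (w k)) (w k - u) = blinfun_apply (g (w k)) (z (Suc k) - u)
      + blinfun_apply (g (w k) - g (z k)) (w k - z (Suc k))
      + blinfun_apply (g (z k)) (w k - z (Suc k))"
    by (simp add: blinfun.diff_left blinfun.diff_right)
  also have "\<dots> \<le> M k * (V (z k) u - V (z (Suc k)) u) + \<epsilon> / 2"
    using 1 2 4 by (simp add: algebra_simps)
  finally show ?thesis .
qed

lemma gmp_sum_le:
  assumes u: "u \<in> Q"
  shows "(\<Sum>i<k. inverse (M i) * blinfun_apply (g u) (w i - u))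
    \<le> V z0 u + (\<Sum>i<k. inverse (M i)) * (\<epsilon> / 2)"
proof -
  have "inverse (M i) * blinfun_apply (g u) (w i - u)
      \<le> V (z i) u - V (z (Suc i)) u + inverse (M i) * (\<epsilon> / 2)" for i
  proof -
    have "w i \<in> Q" using gmp_w_in Q0_subset by blast
    then have "blinfun_apply (g u) (w i - u) \<le> blinfun_apply (g (w i)) (w i - u)"
      using mono_g u by (auto simp: monotone_operator_on_def blinfun.diff_left)
    also note gmp_step [OF u]
    finally have "inverse (M i) * blinfun_apply (g u) (w i - u)
        \<le> inverse (M i) * (M i * (V (z i) u - V (z (Suc i)) u) + \<epsilon> / 2)"
      using gmp_M_pos by (intro mult_left_mono) (auto intro: less_imp_le)
    also have "\<dots> = V (z i) u - V (z (Suc i)) u + inverse (M i) * (\<epsilon> / 2)"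
      using gmp_M_pos [of i] by (simp add: field_simps)
    finally show ?thesis .
  qed
  then have "(\<Sum>i<k. inverse (M i) * blinfun_apply (g u) (w i - u))
      \<le> (\<Sum>i<k. V (z i) u - V (z (Suc i)) u + inverse (M i) * (\<epsilon> / 2))"
    by (intro sum_mono)
  also have "\<dots> = V (z 0) u - V (z k) u + (\<Sum>i<k. inverse (M i)) * (\<epsilon> / 2)"
    by (simp add: sum.distrib sum_distrib_right sum_lessThan_telescope' [of "\<lambda>i. V (z i) u"])
  also have "\<dots> \<le> V z0 u + (\<Sum>i<k. inverse (M i)) * (\<epsilon> / 2)"
    using bregman_nonneg [of "z k" u] gmp_invariant u by (simp add: gmp_z_def)
  finally show ?thesis .
qed

lemma gmp_output_gap:
  assumes u: "u \<in> Q" and k: "1 \<le> k" and Mi: "Mi \<le> 4 * Lam"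
  shows "blinfun_apply (g u) (gmp_output Q Q0 gd g \<epsilon> Mi z0 k - u)
    \<le> 2 * Lam / real k * V z0 u + \<epsilon> / 2"
proof -
  define S where "S = (\<Sum>i<k. inverse (M i))"
  have Lam: "0 < Lam" using L_pos eps by (simp add: Lam_def)
  have "(\<Sum>i<k. inverse (2 * Lam)) \<le> S"
    unfolding S_def using gmp_M_pos gmp_M_le [OF Mi] by (intro sum_mono le_imp_inverse_le) auto
  then have S: "real k / (2 * Lam) \<le> S" by (simp add: field_simps)
  moreover have "0 < real k / (2 * Lam)" using Lam k by simp
  ultimately have S_pos: "0 < S" by linarith
  \<comment> \<open>As \<open>g u\<close> is linear, the weighted sum of gaps is \<open>S\<close>
    times the gap at the averaged point.\<close>
  have "(\<Sum>i<k. inverse (M i) * blinfun_apply (g u) (w i - u))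
      = blinfun_apply (g u) (\<Sum>i<k. inverse (M i) *\<^sub>R w i) - S * blinfun_apply (g u) u"
    by (simp add: S_def blinfun.diff_right blinfun.sum_right blinfun.scaleR_right
        sum_subtractf sum_distrib_right right_diff_distrib)
  then have "blinfun_apply (g u) (gmp_output Q Q0 gd g \<epsilon> Mi z0 k - u)
      = inverse S * (\<Sum>i<k. inverse (M i) * blinfun_apply (g u) (w i - u))"
    using S_pos
    by (simp add: gmp_output_def flip: S_def)
       (simp add: blinfun.diff_right blinfun.scaleR_right right_diff_distrib)
  also have "\<dots> \<le> inverse S * (V z0 u + S * (\<epsilon> / 2))"
    using gmp_sum_le [OF u, of k] S_pos by (intro mult_left_mono) (auto simp: S_def)
  also have "\<dots> = inverse S * V z0 u + \<epsilon> / 2"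
    using S_pos by (simp add: field_simps)
  \<comment> \<open>Averaging leaves \<open>\<epsilon> / 2\<close> unchanged; only the divergence
    term gains the factor \<open>1 / S\<close>.\<close>
  also have "inverse S * V z0 u \<le> inverse (real k / (2 * Lam)) * V z0 u"
    using S Lam k bregman_nonneg [OF z0 u]
    by (intro mult_right_mono le_imp_inverse_le) auto
  finally show ?thesis by simp
qed

end

section \<open>Passage to the supremum over \<open>C\<close>\<close>

theorem corollary2:
  fixes Q Q0 C :: "'a::real_normed_vector set"
    and g gd :: "'a \<Rightarrow> 'a \<Rightarrow>\<^sub>L real"
    and d :: "'a \<Rightarrow> real"
    and L \<nu> \<epsilon> Mi :: real
    and z0 :: 'a
  assumes fin_dim: "\<exists>B :: 'a set. finite B \<and> span B = UNIV"
    and convex_Q: "convex Q"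
    and cont_g: "continuous_on Q g"
    and mono_g: "monotone_operator_on Q g"
    and VI_solvable: "\<exists>xs\<in>Q. \<forall>x\<in>Q. blinfun_apply (g x) (xs - x) \<le> 0"
    and prox: "prox_setup Q Q0 d gd"
    and prox_exists: "\<forall>x\<in>Q0. \<forall>s M. 0 < M \<longrightarrow> (\<exists>xt. is_prox Q Q0 gd x s M xt)"
    and nu: "0 \<le> \<nu>" "\<nu> \<le> 1"
    and L_nonneg: "0 \<le> L"
    and hoelder: "\<forall>x\<in>Q. \<forall>y\<in>Q. norm (g x - g y) \<le> L * norm (x - y) powr \<nu>"
    and eps: "0 < \<epsilon>"
    and Mi_pos: "0 < Mi"
    \<comment> \<open>The bound fails for arbitrarily large initial guesses of the constant below. This is the
       condition that the first trial value \<open>Mi / 2\<close> is at most twice that constant.\<close>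
    and Mi_guess: "Mi \<le> 4 * (\<epsilon> powr (- ((1 - \<nu>) / (1 + \<nu>))) * L powr (2 / (1 + \<nu>)))"
    and z0: "z0 \<in> Q0" "is_arg_min d (\<lambda>u. u \<in> Q) z0"
    and C: "C \<subseteq> Q" "C \<noteq> {}" "convex C" "compact C"
  shows "\<forall>k\<ge>1.
    (SUP u\<in>C. blinfun_apply (g u) (gmp_output Q Q0 gd g \<epsilon> Mi z0 k - u))
      \<le> 2 * L powr (2 / (1 + \<nu>)) / (real k * \<epsilon> powr ((1 - \<nu>) / (1 + \<nu>)))
          * (SUP u\<in>C. bregman d gd z0 u) + \<epsilon> / 2"
proof (intro allI impI)
  fix k :: nat
  assume k: "1 \<le> k"
  \<comment> \<open>For \<open>L = 0\<close> the bound \<open>Mi_guess\<close> would force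
    \<open>Mi \<le> 0\<close>.\<close>
  have "L \<noteq> 0" using Mi_guess Mi_pos by auto
  then interpret mirror_prox Q Q0 g gd d L \<nu> \<epsilon> Mi z0
    using mono_g prox prox_exists nu L_nonneg hoelder eps Mi_pos z0 by unfold_locales auto
  \<comment> \<open>Compactness makes the divergence bounded on \<open>C\<close>, so that its
    \<open>SUP\<close> really is an upper bound.\<close>
  have "continuous_on C (bregman d gd z0)"
    unfolding bregman_def using prox C(1)
    by (intro continuous_intros) (auto simp: prox_setup_def intro: continuous_on_subset)
  then have "bdd_above (bregman d gd z0 ` C)"
    using C(4) by (intro bounded_imp_bdd_above compact_imp_bounded compact_continuous_image)
  then have V_le: "bregman d gd z0 u \<le> (SUP u\<in>C. bregman d gd z0 u)" if "u \<in> C" for u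
    using that by (intro cSUP_upper)
  have Lam: "2 * Lam / real k
      = 2 * L powr (2 / (1 + \<nu>)) / (real k * \<epsilon> powr ((1 - \<nu>) / (1 + \<nu>)))"
    by (simp add: Lam_def powr_minus_divide)
  have "blinfun_apply (g u) (gmp_output Q Q0 gd g \<epsilon> Mi z0 k - u)
      \<le> 2 * Lam / real k * (SUP u\<in>C. bregman d gd z0 u) + \<epsilon> / 2" if "u \<in> C" for u
  proof -
    have "blinfun_apply (g u) (gmp_output Q Q0 gd g \<epsilon> Mi z0 k - u)
        \<le> 2 * Lam / real k * bregman d gd z0 u + \<epsilon> / 2"
      using that C(1) k Mi_guess by (intro gmp_output_gap) (auto simp: Lam_def)
    also have "\<dots> \<le> 2 * Lam / real k * (SUP u\<in>C. bregman d gd z0 u) + \<epsilon> / 2"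
      using V_le [OF that] by (intro add_right_mono mult_left_mono) (auto simp: Lam_def)
    finally show ?thesis .
  qed
  then show "(SUP u\<in>C. blinfun_apply (g u) (gmp_output Q Q0 gd g \<epsilon> Mi z0 k - u))
      \<le> 2 * L powr (2 / (1 + \<nu>)) / (real k * \<epsilon> powr ((1 - \<nu>) / (1 + \<nu>)))
          * (SUP u\<in>C. bregman d gd z0 u) + \<epsilon> / 2"
    unfolding Lam using C(2) by (intro cSUP_least)
qed

end
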